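(* Let $\mathcal{C}$ be a finite connected category, let $R$ be a ring of integers and let $\varphi\colon B^S(\mathcal{C})\to R$ be a ring homomorphism. Then there exists a simple $\mathcal{C}$-set $S$ such that $\varphi=\varphi_S\cdot 1_R$, that is, $\varphi(u)=\varphi_S(u)\cdot 1_R$ for all $u\in B^S(\mathcal{C})$.
   Context: For a finite category $\mathcal{C}$ with object set $\mathcal{C}_0$, a $\mathcal{C}$-set is a covariant functor $\Omega$ from $\mathcal{C}$ to the category of finite sets; morphisms of $\mathcal{C}$-sets are natural transformations, and $\operatorname{Hom}_{\mathcal{C}\text{-set}}(\Omega,\Psi)$ denotes the set of them; a $\mathcal{C}$-subset is a subfunctor. Disjoint unions and products of $\mathcal{C}$-sets are formed objectwise. A $\mathcal{C}$-set is simple if it is non-empty and its only $\mathcal{C}$-subsets are itself and the empty $\mathcal{C}$-set (sending every object to $\emptyset$). The socle $\operatorname{soc}(\Omega)$ is the union of all simple $\mathcal{C}$-subsets of $\Omega$ (this union is disjoint). $1_{\mathcal{C}}$ is the $\mathcal{C}$-set sending every object to a one-point set. The simple Burnside ring $B^S(\mathcal{C})$ is the Grothendieck group, with respect to disjoint union, of isomorphism classes of finite disjoint unions of simple $\mathcal{C}$-sets (equivalently, the free abelian group on isomorphism classes of simple $\mathcal{C}$-sets), with the bilinear product determined by $[S]\star[T]=[\operatorname{soc}(S\times T)]$ and identity element $[\operatorname{soc}(1_{\mathcal{C}})]$. Ring homomorphisms preserve identity elements, and $1_R$ denotes the identity element of $R$. For a simple $\mathcal{C}$-set $S$, the mark of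 $S$ is the ring homomorphism $\varphi_S\colon B^S(\mathcal{C})\to\mathbb{Z}$ determined by $[\Omega]\mapsto|\operatorname{Hom}_{\mathcal{C}\text{-set}}(S,\Omega)|$. *)

theory Defs
  imports
    "HOL-Algebra.Free_Abelian_Groups"
    "HOL-Algebra.Generated_Fields"
    "HOL-Algebra.Embedded_Algebras"
    "HOL-Algebra.Polynomials"
begin

section \<open>Finite connected categories\<close>

text \<open>\<open>Comp C g f\<close> is the composite of \<open>f : a \<rightarrow> b\<close> followed by \<open>g : b \<rightarrow> c\<close>.\<close>

record ('o, 'm) cat =
  Obj :: "'o set"
  Arr :: "'m set"
  Dom :: "'m \<Rightarrow> 'o"
  Cod :: "'m \<Rightarrow> 'o"
  Ident :: "'o \<Rightarrow> 'm"
  Comp :: "'m \<Rightarrow> 'm \<Rightarrow> 'm"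

locale category =
  fixes C :: "('o, 'm) cat"
  assumes Dom_in: "f \<in> Arr C \<Longrightarrow> Dom C f \<in> Obj C"
    and Cod_in: "f \<in> Arr C \<Longrightarrow> Cod C f \<in> Obj C"
    and Ident_in: "a \<in> Obj C \<Longrightarrow> Ident C a \<in> Arr C"
    and Dom_Ident: "a \<in> Obj C \<Longrightarrow> Dom C (Ident C a) = a"
    and Cod_Ident: "a \<in> Obj C \<Longrightarrow> Cod C (Ident C a) = a"
    and Comp_in: "\<lbrakk>f \<in> Arr C; g \<in> Arr C; Dom C g = Cod C f\<rbrakk> \<Longrightarrow> Comp C g f \<in> Arr C"
    and Dom_Comp: "\<lbrakk>f \<in> Arr C; g \<in> Arr C; Dom C g = Cod C f\<rbrakk>
        \<Longrightarrow> Dom C (Comp C g f) = Dom C f"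
    and Cod_Comp: "\<lbrakk>f \<in> Arr C; g \<in> Arr C; Dom C g = Cod C f\<rbrakk>
        \<Longrightarrow> Cod C (Comp C g f) = Cod C g"
    and Comp_Ident_right: "f \<in> Arr C \<Longrightarrow> Comp C f (Ident C (Dom C f)) = f"
    and Comp_Ident_left: "f \<in> Arr C \<Longrightarrow> Comp C (Ident C (Cod C f)) f = f"
    and Comp_assoc: "\<lbrakk>f \<in> Arr C; g \<in> Arr C; h \<in> Arr C; Dom C g = Cod C f; Dom C h = Cod C g\<rbrakk>
        \<Longrightarrow> Comp C h (Comp C g f) = Comp C (Comp C h g) f"

locale finite_category = category +
  assumes finite_Obj: "finite (Obj C)"
    and finite_Arr: "finite (Arr C)"

locale finite_connected_category = finite_category +
  assumes Obj_nonempty: "Obj C \<noteq> {}"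
    and zigzag: "\<lbrakk>a \<in> Obj C; b \<in> Obj C\<rbrakk> \<Longrightarrow>
        (a, b) \<in> ({(Dom C f, Cod C f) |f. f \<in> Arr C} \<union> {(Cod C f, Dom C f) |f. f \<in> Arr C})\<^sup>*"


section \<open>C-sets\<close>

record ('o, 'm, 'x) cset =
  Fib :: "'o \<Rightarrow> 'x set"
  Act :: "'m \<Rightarrow> 'x \<Rightarrow> 'x"

definition is_cset :: "('o, 'm) cat \<Rightarrow> ('o, 'm, 'x) cset \<Rightarrow> bool" where
  "is_cset C \<Omega> \<longleftrightarrow>
     (\<forall>a\<in>Obj C. finite (Fib \<Omega> a)) \<and>
     (\<forall>f\<in>Arr C. Act \<Omega> f \<in> Fib \<Omega> (Dom C f) \<rightarrow> Fib \<Omega> (Cod C f)) \<and>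
     (\<forall>a\<in>Obj C. \<forall>x\<in>Fib \<Omega> a. Act \<Omega> (Ident C a) x = x) \<and>
     (\<forall>f\<in>Arr C. \<forall>g\<in>Arr C. Dom C g = Cod C f \<longrightarrow>
        (\<forall>x\<in>Fib \<Omega> (Dom C f). Act \<Omega> (Comp C g f) x = Act \<Omega> g (Act \<Omega> f x)))"

text \<open>Natural transformations are taken extensional, so that they can be counted.\<close>

definition Hom :: "('o, 'm) cat \<Rightarrow> ('o, 'm, 'x) cset \<Rightarrow> ('o, 'm, 'y) cset \<Rightarrow> ('o \<Rightarrow> 'x \<Rightarrow> 'y) set" where
  "Hom C \<Omega> \<Psi> =
     {\<eta> \<in> (\<Pi>\<^sub>E a\<in>Obj C. Fib \<Omega> a \<rightarrow>\<^sub>E Fib \<Psi> a).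
        \<forall>f\<in>Arr C. \<forall>x\<in>Fib \<Omega> (Dom C f).
          \<eta> (Cod C f) (Act \<Omega> f x) = Act \<Psi> f (\<eta> (Dom C f) x)}"

definition cset_iso :: "('o, 'm) cat \<Rightarrow> ('o, 'm, 'x) cset \<Rightarrow> ('o, 'm, 'y) cset \<Rightarrow> bool" where
  "cset_iso C \<Omega> \<Psi> \<longleftrightarrow>
     (\<exists>\<eta>\<in>Hom C \<Omega> \<Psi>. \<exists>\<theta>\<in>Hom C \<Psi> \<Omega>.
        \<forall>a\<in>Obj C. (\<forall>x\<in>Fib \<Omega> a. \<theta> a (\<eta> a x) = x) \<and> (\<forall>y\<in>Fib \<Psi> a. \<eta> a (\<theta> a y) = y))"

text \<open>
  A C-subset is given by its family of values; this family is required to be empty off the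
  objects of \<open>C\<close>, so that distinct families are distinct subfunctors.
\<close>

definition csubset :: "('o, 'm) cat \<Rightarrow> ('o \<Rightarrow> 'x set) \<Rightarrow> ('o, 'm, 'x) cset \<Rightarrow> bool" where
  "csubset C U \<Omega> \<longleftrightarrow>
     (\<forall>a\<in>Obj C. U a \<subseteq> Fib \<Omega> a) \<and> (\<forall>a. a \<notin> Obj C \<longrightarrow> U a = {}) \<and>
     (\<forall>f\<in>Arr C. Act \<Omega> f ` U (Dom C f) \<subseteq> U (Cod C f))"

definition restrict_cset :: "('o, 'm, 'x) cset \<Rightarrow> ('o \<Rightarrow> 'x set) \<Rightarrow> ('o, 'm, 'x) cset" where
  "restrict_cset \<Omega> U = \<Omega>\<lparr>Fib := U\<rparr>"

definition simple_cset :: "('o, 'm) cat \<Rightarrow> ('o, 'm, 'x) cset \<Rightarrow> bool" where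
  "simple_cset C \<Omega> \<longleftrightarrow>
     is_cset C \<Omega> \<and> (\<exists>a\<in>Obj C. Fib \<Omega> a \<noteq> {}) \<and>
     (\<forall>U. csubset C U \<Omega> \<longrightarrow> (\<forall>a\<in>Obj C. U a = {}) \<or> (\<forall>a\<in>Obj C. U a = Fib \<Omega> a))"

definition simple_csubsets :: "('o, 'm) cat \<Rightarrow> ('o, 'm, 'x) cset \<Rightarrow> ('o \<Rightarrow> 'x set) set" where
  "simple_csubsets C \<Omega> = {U. csubset C U \<Omega> \<and> simple_cset C (restrict_cset \<Omega> U)}"

definition soc :: "('o, 'm) cat \<Rightarrow> ('o, 'm, 'x) cset \<Rightarrow> ('o, 'm, 'x) cset" where
  "soc C \<Omega> = restrict_cset \<Omega> (\<lambda>a. \<Union>U\<in>simple_csubsets C \<Omega>. U a)"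

definition prod_cset :: "('o, 'm, 'x) cset \<Rightarrow> ('o, 'm, 'y) cset \<Rightarrow> ('o, 'm, 'x \<times> 'y) cset" where
  "prod_cset \<Omega> \<Psi> = \<lparr>Fib = (\<lambda>a. Fib \<Omega> a \<times> Fib \<Psi> a), Act = (\<lambda>f. map_prod (Act \<Omega> f) (Act \<Psi> f))\<rparr>"

definition one_cset :: "('o, 'm, unit) cset" where
  "one_cset = \<lparr>Fib = (\<lambda>a. {()}), Act = (\<lambda>f x. x)\<rparr>"


section \<open>The simple Burnside ring\<close>

text \<open>
  Values being finite sets, each C-set is isomorphic to one with values in sets of natural
  numbers (see \<open>cset_class_nonempty\<close> below), so isomorphism classes of C-sets over any type
  are represented by the C-sets over \<^typ>\<open>nat\<close> which they contain.
\<close>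

definition cset_class :: "('o, 'm) cat \<Rightarrow> ('o, 'm, 'x) cset \<Rightarrow> ('o, 'm, nat) cset set" where
  "cset_class C \<Omega> = {\<Psi>. is_cset C \<Psi> \<and> cset_iso C \<Omega> \<Psi>}"

lemma cset_class_nonempty:
  assumes "category C" and \<Omega>: "is_cset C \<Omega>"
  shows "cset_class C \<Omega> \<noteq> {}"
proof -
  interpret category C by fact
  have fin: "finite (Fib \<Omega> a)" if "a \<in> Obj C" for a
    using \<Omega> that by (simp add: is_cset_def)
  have act: "Act \<Omega> f x \<in> Fib \<Omega> (Cod C f)" if "f \<in> Arr C" "x \<in> Fib \<Omega> (Dom C f)" for f x
    using \<Omega> that unfolding is_cset_def by blast
  have act_Ident: "Act \<Omega> (Ident C a) x = x" if "a \<in> Obj C" "x \<in> Fib \<Omega> a" for a x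
    using \<Omega> that unfolding is_cset_def by blast
  have act_Comp: "Act \<Omega> (Comp C g f) x = Act \<Omega> g (Act \<Omega> f x)"
    if "f \<in> Arr C" "g \<in> Arr C" "Dom C g = Cod C f" "x \<in> Fib \<Omega> (Dom C f)" for f g x
    using \<Omega> that unfolding is_cset_def by blast
  define e where "e a = (SOME h :: 'c \<Rightarrow> nat. inj_on h (Fib \<Omega> a))" for a
  have e: "inj_on (e a) (Fib \<Omega> a)" if "a \<in> Obj C" for a
    unfolding e_def using finite_imp_inj_to_nat_seg[OF fin[OF that]] by (metis (no_types) someI_ex)
  define d where "d a = inv_into (Fib \<Omega> a) (e a)" for a
  have de: "d a (e a x) = x" if "a \<in> Obj C" "x \<in> Fib \<Omega> a" for a x
    using e that by (simp add: d_def)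
  define \<Psi> where "\<Psi> = \<lparr>Fib = (\<lambda>a. e a ` Fib \<Omega> a),
    Act = (\<lambda>f n. e (Cod C f) (Act \<Omega> f (d (Dom C f) n)))\<rparr>"
  have Fib: "Fib \<Psi> a = e a ` Fib \<Omega> a" for a
    by (simp add: \<Psi>_def)
  have Act: "Act \<Psi> f (e (Dom C f) x) = e (Cod C f) (Act \<Omega> f x)"
    if "f \<in> Arr C" "x \<in> Fib \<Omega> (Dom C f)" for f x
    using de[OF Dom_in that(2)] that(1) by (simp add: \<Psi>_def)
  have "is_cset C \<Psi>"
    unfolding is_cset_def
  proof (intro conjI ballI impI)
    show "finite (Fib \<Psi> a)" if "a \<in> Obj C" for a
      using fin[OF that] by (simp add: Fib)
    show "Act \<Psi> f \<in> Fib \<Psi> (Dom C f) \<rightarrow> Fib \<Psi> (Cod C f)" if "f \<in> Arr C" for f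
      using act[OF that] Act[OF that] by (auto simp: Fib)
    show "Act \<Psi> (Ident C a) n = n" if a: "a \<in> Obj C" and n: "n \<in> Fib \<Psi> a" for a n
    proof -
      obtain x where x: "x \<in> Fib \<Omega> a" and n: "n = e a x"
        using n by (auto simp: Fib)
      show ?thesis
        using Act[OF Ident_in[OF a]] x by (simp add: n Dom_Ident[OF a] Cod_Ident[OF a] act_Ident[OF a])
    qed
    show "Act \<Psi> (Comp C g f) n = Act \<Psi> g (Act \<Psi> f n)"
      if fg: "f \<in> Arr C" "g \<in> Arr C" "Dom C g = Cod C f" and n_in: "n \<in> Fib \<Psi> (Dom C f)" for f g n
    proof -
      obtain x where x: "x \<in> Fib \<Omega> (Dom C f)" and n: "n = e (Dom C f) x"
        using n_in by (auto simp: Fib)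
      have "Act \<Psi> (Comp C g f) n = e (Cod C g) (Act \<Omega> (Comp C g f) x)"
        using Act[OF Comp_in[OF fg]] x by (simp add: n Dom_Comp[OF fg] Cod_Comp[OF fg])
      also have "\<dots> = e (Cod C g) (Act \<Omega> g (Act \<Omega> f x))"
        by (simp only: act_Comp[OF fg x])
      also have "\<dots> = Act \<Psi> g (Act \<Psi> f n)"
        using Act[OF fg(2)] act[OF fg(1) x] by (simp add: n fg(3) Act[OF fg(1) x])
      finally show ?thesis .
    qed
  qed
  moreover define \<eta> where "\<eta> = (\<lambda>a\<in>Obj C. \<lambda>x\<in>Fib \<Omega> a. e a x)"
  have "\<eta> \<in> Hom C \<Omega> \<Psi>"
    unfolding Hom_def \<eta>_def using act Act Dom_in Cod_in by (simp add: Fib PiE_iff extensional_def)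
  moreover define \<theta> where "\<theta> = (\<lambda>a\<in>Obj C. \<lambda>n\<in>Fib \<Psi> a. d a n)"
  have "\<theta> \<in> Hom C \<Psi> \<Omega>"
    unfolding Hom_def \<theta>_def using act Act Dom_in Cod_in de by (simp add: Fib PiE_iff extensional_def)
  moreover have "\<forall>a\<in>Obj C. (\<forall>x\<in>Fib \<Omega> a. \<theta> a (\<eta> a x) = x) \<and> (\<forall>y\<in>Fib \<Psi> a. \<eta> a (\<theta> a y) = y)"
    using de by (simp add: Fib \<eta>_def \<theta>_def)
  ultimately show ?thesis
    unfolding cset_class_def cset_iso_def by blast
qed

definition simple_classes :: "('o, 'm) cat \<Rightarrow> ('o, 'm, nat) cset set set" where
  "simple_classes C = {cset_class C S |S :: ('o, 'm, nat) cset. simple_cset C S}"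

definition class_rep :: "('o, 'm, nat) cset set \<Rightarrow> ('o, 'm, nat) cset" where
  "class_rep c = (SOME \<Omega>. \<Omega> \<in> c)"

text \<open>
  The additive group is the free abelian group on the isomorphism classes of simple C-sets.
  A disjoint union \<open>\<Omega>\<close> of finitely many simple C-sets is the disjoint union of its simple
  C-subsets, so its class is the sum of theirs.
\<close>

definition burnside_class ::
    "('o, 'm) cat \<Rightarrow> ('o, 'm, 'x) cset \<Rightarrow> ('o, 'm, nat) cset set \<Rightarrow>\<^sub>0 int" where
  "burnside_class C \<Omega> = (\<Sum>U\<in>simple_csubsets C \<Omega>. frag_of (cset_class C (restrict_cset \<Omega> U)))"

definition burnside_mult :: "('o, 'm) cat \<Rightarrow> (('o, 'm, nat) cset set \<Rightarrow>\<^sub>0 int) \<Rightarrow>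
    (('o, 'm, nat) cset set \<Rightarrow>\<^sub>0 int) \<Rightarrow> (('o, 'm, nat) cset set \<Rightarrow>\<^sub>0 int)" where
  "burnside_mult C u v =
     frag_extend (\<lambda>s. frag_extend (\<lambda>t.
       burnside_class C (soc C (prod_cset (class_rep s) (class_rep t)))) v) u"

definition simple_burnside_ring ::
    "('o, 'm) cat \<Rightarrow> (('o, 'm, nat) cset set \<Rightarrow>\<^sub>0 int) ring" where
  "simple_burnside_ring C =
     \<lparr>carrier = carrier (free_Abelian_group (simple_classes C)),
      monoid.mult = burnside_mult C,
      one = burnside_class C (soc C one_cset),
      zero = 0,
      add = (+)\<rparr>"

text \<open>The mark is additive in the C-set, hence determined by its values on simple ones.\<close>

definition mark ::
    "('o, 'm) cat \<Rightarrow> ('o, 'm, 'x) cset \<Rightarrow> (('o, 'm, nat) cset set \<Rightarrow>\<^sub>0 int) \<Rightarrow> int" where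
  "mark C S u =
     (\<Sum>t\<in>Poly_Mapping.keys u. Poly_Mapping.lookup u t * int (card (Hom C S (class_rep t))))"


section \<open>Rings of integers of number fields\<close>

text \<open>
  A number field is a field of characteristic 0 that is finite-dimensional over its prime field
  \<open>generate_field K {}\<close>, which is then a copy of the rationals.
\<close>

definition number_field :: "('k, 'b) ring_scheme \<Rightarrow> bool" where
  "number_field K \<longleftrightarrow>
     field K \<and> inj (\<lambda>n::int. [n] \<cdot>\<^bsub>K\<^esub> \<one>\<^bsub>K\<^esub>) \<and>
     ring.finite_dimension K (generate_field K {}) (carrier K)"

text \<open>Coefficient lists start with the leading coefficient, so \<open>\<one> # \<dots>\<close> is a monic polynomial.\<close>

definition algebraic_integer_in :: "('k, 'b) ring_scheme \<Rightarrow> 'k \<Rightarrow> bool" where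
  "algebraic_integer_in K x \<longleftrightarrow>
     (\<exists>p :: int list. ring.eval K (\<one>\<^bsub>K\<^esub> # map (\<lambda>n. [n] \<cdot>\<^bsub>K\<^esub> \<one>\<^bsub>K\<^esub>) p) x = \<zero>\<^bsub>K\<^esub>)"

definition ring_of_integers :: "('k, 'b) ring_scheme \<Rightarrow> ('k, 'b) ring_scheme" where
  "ring_of_integers K = K\<lparr>carrier := {x \<in> carrier K. algebraic_integer_in K x}\<rparr>"

end

theory Submission
  imports Defs
begin

text \<open>
  A simple C-set is generated by any of its elements, so the sizes of simple C-sets are bounded and
  one may choose, among the simple \<open>S\<close> with \<open>\<phi>[S] \<noteq> 0\<close>, one of maximal size. Expand
  \<open>\<phi>[S] \<phi>[T]\<close> over the simple subsets \<open>U\<close> of \<open>S \<times> T\<close>. Each \<open>U\<close> projects onto \<open>S\<close>, so by maximality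
  \<open>\<phi>[U] = 0\<close> unless the projection is bijective, i.e. \<open>U\<close> is the graph of a morphism \<open>S \<rightarrow> T\<close>, in which
  case \<open>U\<close> is isomorphic to \<open>S\<close>. Hence \<open>\<phi>[S] \<phi>[T] = |Hom(S, T)| \<phi>[S]\<close>, and \<open>\<phi>[S]\<close> can be cancelled.
\<close>

section \<open>C-sets, isomorphisms and simplicity\<close>

lemma is_csetD:
  assumes "is_cset C \<Omega>"
  shows is_cset_finite: "a \<in> Obj C \<Longrightarrow> finite (Fib \<Omega> a)"
    and is_cset_Act: "f \<in> Arr C \<Longrightarrow> x \<in> Fib \<Omega> (Dom C f) \<Longrightarrow> Act \<Omega> f x \<in> Fib \<Omega> (Cod C f)"
    and is_cset_Ident: "a \<in> Obj C \<Longrightarrow> x \<in> Fib \<Omega> a \<Longrightarrow> Act \<Omega> (Ident C a) x = x"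
    and is_cset_Comp: "f \<in> Arr C \<Longrightarrow> g \<in> Arr C \<Longrightarrow> Dom C g = Cod C f \<Longrightarrow> x \<in> Fib \<Omega> (Dom C f) \<Longrightarrow>
      Act \<Omega> (Comp C g f) x = Act \<Omega> g (Act \<Omega> f x)"
  using assms unfolding is_cset_def by blast+

lemma simple_cset_is_cset: "simple_cset C \<Omega> \<Longrightarrow> is_cset C \<Omega>"
  by (simp add: simple_cset_def)

lemma simple_cset_nonempty:
  assumes "simple_cset C \<Omega>"
  obtains a x where "a \<in> Obj C" and "x \<in> Fib \<Omega> a"
  using assms unfolding simple_cset_def by blast

lemma simple_cset_csubset:
  assumes "simple_cset C \<Omega>" and "csubset C U \<Omega>"
  shows "(\<forall>a\<in>Obj C. U a = {}) \<or> (\<forall>a\<in>Obj C. U a = Fib \<Omega> a)"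
  using assms unfolding simple_cset_def by simp

lemma csubset_simple_full:
  assumes "simple_cset C \<Omega>" and "csubset C U \<Omega>" and "a \<in> Obj C" and "x \<in> U a" and "b \<in> Obj C"
  shows "U b = Fib \<Omega> b"
  using simple_cset_csubset[OF assms(1,2)] assms(3-5) by auto

lemma csubsetI:
  assumes "\<And>a x. a \<in> Obj C \<Longrightarrow> x \<in> U a \<Longrightarrow> x \<in> Fib \<Omega> a"
    and "\<And>a. a \<notin> Obj C \<Longrightarrow> U a = {}"
    and "\<And>f x. f \<in> Arr C \<Longrightarrow> x \<in> U (Dom C f) \<Longrightarrow> Act \<Omega> f x \<in> U (Cod C f)"
  shows "csubset C U \<Omega>"
  using assms unfolding csubset_def by blast

lemma csubsetD:
  assumes "csubset C U \<Omega>"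
  shows csubset_Fib: "a \<in> Obj C \<Longrightarrow> x \<in> U a \<Longrightarrow> x \<in> Fib \<Omega> a"
    and csubset_off: "a \<notin> Obj C \<Longrightarrow> U a = {}"
    and csubset_Act: "f \<in> Arr C \<Longrightarrow> x \<in> U (Dom C f) \<Longrightarrow> Act \<Omega> f x \<in> U (Cod C f)"
  using assms unfolding csubset_def by blast+

lemma restrict_cset_simps [simp]:
  "Fib (restrict_cset \<Omega> U) = U"
  "Act (restrict_cset \<Omega> U) = Act \<Omega>"
  "restrict_cset (restrict_cset \<Omega> V) U = restrict_cset \<Omega> U"
  by (simp_all add: restrict_cset_def)

lemma simple_csubsetD:
  assumes "U \<in> simple_csubsets C \<Omega>"
  shows "csubset C U \<Omega>" and "simple_cset C (restrict_cset \<Omega> U)"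
  using assms by (simp_all add: simple_csubsets_def)

text \<open>A simple C-subset is a member of the union that forms the socle, so it lies inside the
  socle. The action is the same on both sides, so restricting to \<open>U\<close> gives the same
  C-set and simplicity is unaffected.\<close>

lemma simple_csubsets_soc: "simple_csubsets C (soc C \<Omega>) = simple_csubsets C \<Omega>"
proof -
  have "csubset C U (soc C \<Omega>) \<longleftrightarrow> csubset C U \<Omega>" if "simple_cset C (restrict_cset \<Omega> U)" for U
  proof
    assume U: "csubset C U (soc C \<Omega>)"
    have "Fib (soc C \<Omega>) a \<subseteq> Fib \<Omega> a" if "a \<in> Obj C" for a
      using that by (auto simp: soc_def simple_csubsets_def csubset_def)
    with U have "U a \<subseteq> Fib \<Omega> a" if "a \<in> Obj C" for a
      using that unfolding csubset_def by blast
    with U show "csubset C U \<Omega>"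
      unfolding csubset_def by (simp add: soc_def)
  next
    assume U: "csubset C U \<Omega>"
    with that have "U a \<subseteq> Fib (soc C \<Omega>) a" for a
      by (auto simp: soc_def simple_csubsets_def)
    with U show "csubset C U (soc C \<Omega>)"
      unfolding csubset_def by (auto simp: soc_def)
  qed
  then show ?thesis
    unfolding simple_csubsets_def by (auto simp: soc_def)
qed

text \<open>Removes the socle both from the product of two generators and from the identity element,
  so that each is a sum over the simple subsets of a plain C-set.\<close>

lemma burnside_class_soc: "burnside_class C (soc C \<Omega>) = burnside_class C \<Omega>"
  unfolding burnside_class_def simple_csubsets_soc by (simp add: soc_def)

lemma HomD:
  assumes "\<eta> \<in> Hom C \<Omega> \<Psi>"
  shows Hom_Fib: "a \<in> Obj C \<Longrightarrow> x \<in> Fib \<Omega> a \<Longrightarrow> \<eta> a x \<in> Fib \<Psi> a"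
    and Hom_Act: "f \<in> Arr C \<Longrightarrow> x \<in> Fib \<Omega> (Dom C f) \<Longrightarrow>
      \<eta> (Cod C f) (Act \<Omega> f x) = Act \<Psi> f (\<eta> (Dom C f) x)"
  using assms unfolding Hom_def by (auto simp: PiE_iff)

text \<open>The size whose maximum selects \<open>S\<close>: an isomorphism invariant, bounded on
  simple C-sets.\<close>

definition csize :: "('o, 'm) cat \<Rightarrow> ('o, 'm, 'x) cset \<Rightarrow> nat" where
  "csize C \<Omega> = (\<Sum>a\<in>Obj C. card (Fib \<Omega> a))"

lemma cset_iso_sym: "cset_iso C \<Omega> \<Psi> \<Longrightarrow> cset_iso C \<Psi> \<Omega>"
  unfolding cset_iso_def by blast

section \<open>Isomorphism classes of C-sets and their chosen representatives\<close>

context category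
begin

text \<open>The inverse of a natural family of bijections is natural, and restricting both families
  to objects and fibres makes them extensional. Isomorphisms can then be given by plain functions,
  with no care for values elsewhere.\<close>

lemma cset_iso_iff:
  assumes \<Omega>: "is_cset C \<Omega>"
  shows "cset_iso C \<Omega> \<Psi> \<longleftrightarrow>
    (\<exists>h. (\<forall>a\<in>Obj C. bij_betw (h a) (Fib \<Omega> a) (Fib \<Psi> a)) \<and>
      (\<forall>f\<in>Arr C. \<forall>x\<in>Fib \<Omega> (Dom C f). h (Cod C f) (Act \<Omega> f x) = Act \<Psi> f (h (Dom C f) x)))"
    (is "_ \<longleftrightarrow> (\<exists>h. ?bij h \<and> ?eqv h)")
proof
  assume "cset_iso C \<Omega> \<Psi>"
  then obtain \<eta> \<theta> where \<eta>: "\<eta> \<in> Hom C \<Omega> \<Psi>" and \<theta>: "\<theta> \<in> Hom C \<Psi> \<Omega>"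
    and inv: "\<forall>a\<in>Obj C. (\<forall>x\<in>Fib \<Omega> a. \<theta> a (\<eta> a x) = x) \<and> (\<forall>y\<in>Fib \<Psi> a. \<eta> a (\<theta> a y) = y)"
    unfolding cset_iso_def by blast
  have "bij_betw (\<eta> a) (Fib \<Omega> a) (Fib \<Psi> a)" if "a \<in> Obj C" for a
    using inv \<eta> \<theta> that by (intro bij_betwI[where g = "\<theta> a"]) (auto simp: Hom_def PiE_iff)
  moreover have "?eqv \<eta>"
    using \<eta> by (simp add: Hom_def)
  ultimately show "\<exists>h. ?bij h \<and> ?eqv h"
    by blast
next
  assume "\<exists>h. ?bij h \<and> ?eqv h"
  then obtain h where bij: "?bij h" and eqv: "?eqv h"
    by blast
  define \<eta> where "\<eta> = (\<lambda>a\<in>Obj C. \<lambda>x\<in>Fib \<Omega> a. h a x)"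
  define k where "k a = inv_into (Fib \<Omega> a) (h a)" for a
  define \<theta> where "\<theta> = (\<lambda>a\<in>Obj C. \<lambda>y\<in>Fib \<Psi> a. k a y)"
  have hk: "h a (k a y) = y" "k a y \<in> Fib \<Omega> a" if "a \<in> Obj C" "y \<in> Fib \<Psi> a" for a y
    using bij that unfolding k_def by (auto simp: bij_betw_def f_inv_into_f inv_into_into)
  have kh: "k a (h a x) = x" "h a x \<in> Fib \<Psi> a" if "a \<in> Obj C" "x \<in> Fib \<Omega> a" for a x
    using bij that unfolding k_def by (auto simp: bij_betw_def)
  \<comment> \<open>\<open>\<Psi>\<close> is only a target here: that its action respects fibres and
    commutes with \<open>k\<close> is obtained by pulling \<open>y\<close> back to
    \<open>\<Omega>\<close>, acting there, and returning by \<open>h\<close>.\<close>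
  have act: "Act \<Psi> f y \<in> Fib \<Psi> (Cod C f)" "k (Cod C f) (Act \<Psi> f y) = Act \<Omega> f (k (Dom C f) y)"
    if f: "f \<in> Arr C" and y: "y \<in> Fib \<Psi> (Dom C f)" for f y
  proof -
    note ky = hk[OF Dom_in[OF f] y]
    have "Act \<Psi> f y = h (Cod C f) (Act \<Omega> f (k (Dom C f) y))"
      using bspec[OF bspec[OF eqv f] ky(2)] by (simp add: ky(1))
    then show "Act \<Psi> f y \<in> Fib \<Psi> (Cod C f)" "k (Cod C f) (Act \<Psi> f y) = Act \<Omega> f (k (Dom C f) y)"
      using kh[OF Cod_in[OF f] is_cset_Act[OF \<Omega> f ky(2)]] by simp_all
  qed
  have "\<eta> \<in> Hom C \<Omega> \<Psi>"
    unfolding Hom_def \<eta>_def using kh eqv is_cset_Act[OF \<Omega>] Dom_in Cod_in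
    by (simp add: PiE_iff extensional_def)
  moreover have "\<theta> \<in> Hom C \<Psi> \<Omega>"
    unfolding Hom_def \<theta>_def using hk act Dom_in Cod_in
    by (simp add: PiE_iff extensional_def)
  ultimately show "cset_iso C \<Omega> \<Psi>"
    unfolding cset_iso_def using hk kh
    by (intro bexI[where x = \<eta>] bexI[where x = \<theta>]) (simp_all add: \<eta>_def \<theta>_def)
qed

lemma cset_iso_trans:
  assumes \<Omega>: "is_cset C \<Omega>" and \<Psi>: "is_cset C \<Psi>"
    and "cset_iso C \<Omega> \<Psi>" and "cset_iso C \<Psi> \<Theta>"
  shows "cset_iso C \<Omega> \<Theta>"
proof -
  obtain h where h: "\<forall>a\<in>Obj C. bij_betw (h a) (Fib \<Omega> a) (Fib \<Psi> a)"
    "\<forall>f\<in>Arr C. \<forall>x\<in>Fib \<Omega> (Dom C f). h (Cod C f) (Act \<Omega> f x) = Act \<Psi> f (h (Dom C f) x)"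
    using assms(3) unfolding cset_iso_iff[OF \<Omega>] by blast
  obtain k where k: "\<forall>a\<in>Obj C. bij_betw (k a) (Fib \<Psi> a) (Fib \<Theta> a)"
    "\<forall>f\<in>Arr C. \<forall>x\<in>Fib \<Psi> (Dom C f). k (Cod C f) (Act \<Psi> f x) = Act \<Theta> f (k (Dom C f) x)"
    using assms(4) unfolding cset_iso_iff[OF \<Psi>] by blast
  have "h a x \<in> Fib \<Psi> a" if "a \<in> Obj C" "x \<in> Fib \<Omega> a" for a x
    using h(1) that by (auto simp: bij_betw_def)
  then have "k (Cod C f) (h (Cod C f) (Act \<Omega> f x)) = Act \<Theta> f (k (Dom C f) (h (Dom C f) x))"
    if "f \<in> Arr C" "x \<in> Fib \<Omega> (Dom C f)" for f x
    using h(2) k(2) Dom_in that by simp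
  moreover have "bij_betw (k a \<circ> h a) (Fib \<Omega> a) (Fib \<Theta> a)" if "a \<in> Obj C" for a
    using h(1) k(1) that bij_betw_trans by blast
  ultimately show ?thesis
    unfolding cset_iso_iff[OF \<Omega>] by (intro exI[where x = "\<lambda>a. k a \<circ> h a"]) simp
qed

text \<open>The two C-sets may have elements of different types, as when a subset of a product is
  compared with a factor; their classes both consist of C-sets over \<open>nat\<close>.\<close>

lemma cset_class_eq:
  assumes "is_cset C \<Omega>" and "is_cset C \<Psi>" and "cset_iso C \<Omega> \<Psi>"
  shows "cset_class C \<Omega> = cset_class C \<Psi>"
proof -
  have "cset_iso C \<Omega> \<Theta> \<longleftrightarrow> cset_iso C \<Psi> \<Theta>" for \<Theta> :: "('o, 'm, nat) cset"
    using cset_iso_trans[OF assms(1,2,3)] cset_iso_trans[OF assms(2,1) cset_iso_sym[OF assms(3)]]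
    by blast
  then show ?thesis
    by (simp add: cset_class_def)
qed

lemma csize_iso:
  assumes "is_cset C \<Omega>" and "cset_iso C \<Omega> \<Psi>"
  shows "csize C \<Omega> = csize C \<Psi>"
proof -
  obtain h where "\<forall>a\<in>Obj C. bij_betw (h a) (Fib \<Omega> a) (Fib \<Psi> a)"
    using assms(2) unfolding cset_iso_iff[OF assms(1)] by blast
  then show ?thesis
    unfolding csize_def by (intro sum.cong refl) (auto dest: bij_betw_same_card)
qed

text \<open>A C-subset of \<open>\<Psi>\<close> is the image of its preimage in
  \<open>\<Omega>\<close>, and that preimage is a C-subset, hence empty or everything.\<close>

lemma simple_cset_iso:
  assumes simple: "simple_cset C \<Omega>" and \<Psi>: "is_cset C \<Psi>" and "cset_iso C \<Omega> \<Psi>"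
  shows "simple_cset C \<Psi>"
proof -
  have \<Omega>: "is_cset C \<Omega>"
    using simple by (rule simple_cset_is_cset)
  obtain h where bij: "\<And>a. a \<in> Obj C \<Longrightarrow> bij_betw (h a) (Fib \<Omega> a) (Fib \<Psi> a)"
    and eqv: "\<And>f x. f \<in> Arr C \<Longrightarrow> x \<in> Fib \<Omega> (Dom C f) \<Longrightarrow>
      h (Cod C f) (Act \<Omega> f x) = Act \<Psi> f (h (Dom C f) x)"
    using assms(3) unfolding cset_iso_iff[OF \<Omega>] by blast
  have img: "h a ` Fib \<Omega> a = Fib \<Psi> a" if "a \<in> Obj C" for a
    using bij[OF that] by (simp add: bij_betw_def)
  have "\<exists>a\<in>Obj C. Fib \<Psi> a \<noteq> {}"
    using simple_cset_nonempty[OF simple] img by (metis empty_iff image_is_empty)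
  moreover have "(\<forall>a\<in>Obj C. V a = {}) \<or> (\<forall>a\<in>Obj C. V a = Fib \<Psi> a)" if V: "csubset C V \<Psi>" for V
  proof -
    \<comment> \<open>The preimage of \<open>V\<close> under \<open>h\<close>, cut off outside the
      objects as \<open>csubset\<close> demands.\<close>
    define U where "U a = (if a \<in> Obj C then {x \<in> Fib \<Omega> a. h a x \<in> V a} else {})" for a
    have "Act \<Omega> f x \<in> U (Cod C f)" if f: "f \<in> Arr C" and x: "x \<in> U (Dom C f)" for f x
    proof -
      have x': "x \<in> Fib \<Omega> (Dom C f)" "h (Dom C f) x \<in> V (Dom C f)"
        using x Dom_in[OF f] by (simp_all add: U_def)
      then show ?thesis
        using csubset_Act[OF V f x'(2)] is_cset_Act[OF \<Omega> f x'(1)] Cod_in[OF f]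
        by (simp add: U_def eqv[OF f x'(1)])
    qed
    then have "csubset C U \<Omega>"
      by (rule csubsetI[rotated 2]) (simp_all add: U_def)
    moreover have "V a = h a ` U a" if "a \<in> Obj C" for a
      using img[OF that] csubset_Fib[OF V that] that unfolding U_def by auto
    moreover have "(\<forall>a\<in>Obj C. U a = {}) \<or> (\<forall>a\<in>Obj C. U a = Fib \<Omega> a)"
      by (rule simple_cset_csubset[OF simple \<open>csubset C U \<Omega>\<close>])
    ultimately show ?thesis
      using img by (elim disjE) simp_all
  qed
  ultimately show ?thesis
    using \<Psi> unfolding simple_cset_def by simp
qed

lemma is_cset_restrict:
  assumes "is_cset C \<Omega>" and "csubset C U \<Omega>"
  shows "is_cset C (restrict_cset \<Omega> U)"
proof -
  have sub: "U a \<subseteq> Fib \<Omega> a" if "a \<in> Obj C" for a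
    using csubset_Fib[OF assms(2)] that by blast
  have "finite (U a)" if "a \<in> Obj C" for a
    using sub is_cset_finite[OF assms(1)] that by (blast intro: finite_subset)
  then show ?thesis
    unfolding is_cset_def using sub Dom_in csubset_Act[OF assms(2)] is_csetD[OF assms(1)]
    by (auto simp: subset_eq)
qed

lemma is_cset_prod:
  assumes "is_cset C \<Omega>" and "is_cset C \<Psi>"
  shows "is_cset C (prod_cset \<Omega> \<Psi>)"
  unfolding is_cset_def prod_cset_def
  using is_csetD[OF assms(1)] is_csetD[OF assms(2)] by auto

text \<open>By \<open>cset_class_nonempty\<close> the choice in \<open>class_rep\<close> really
  picks a member, and simplicity passes to it along the isomorphism. This is the passage from simple
  C-sets over any type to generators of the ring.\<close>

lemma class_rep_simple:
  assumes "simple_cset C \<Omega>"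
  shows "simple_cset C (class_rep (cset_class C \<Omega>))"
    and "cset_iso C \<Omega> (class_rep (cset_class C \<Omega>))"
    and "cset_class C (class_rep (cset_class C \<Omega>)) = cset_class C \<Omega>"
    and "cset_class C \<Omega> \<in> simple_classes C"
proof -
  have \<Omega>: "is_cset C \<Omega>"
    using assms by (rule simple_cset_is_cset)
  have "class_rep (cset_class C \<Omega>) \<in> cset_class C \<Omega>"
    unfolding class_rep_def
    using cset_class_nonempty[OF category_axioms \<Omega>] by (simp add: some_in_eq)
  then have rep: "is_cset C (class_rep (cset_class C \<Omega>))"
    and iso: "cset_iso C \<Omega> (class_rep (cset_class C \<Omega>))"
    by (simp_all add: cset_class_def)
  then show simple: "simple_cset C (class_rep (cset_class C \<Omega>))"
    using assms simple_cset_iso by blast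
  show "cset_iso C \<Omega> (class_rep (cset_class C \<Omega>))"
    by (fact iso)
  show eq: "cset_class C (class_rep (cset_class C \<Omega>)) = cset_class C \<Omega>"
    using cset_class_eq[OF \<Omega> rep iso] ..
  show "cset_class C \<Omega> \<in> simple_classes C"
    unfolding simple_classes_def using simple eq by auto
qed

lemma simple_classes_rep:
  assumes "s \<in> simple_classes C"
  shows "simple_cset C (class_rep s)" and "cset_class C (class_rep s) = s"
  using assms class_rep_simple(1,3) unfolding simple_classes_def by auto

end

section \<open>Finiteness and a size bound for simple C-sets\<close>

context finite_category
begin

text \<open>A C-subset is a family of subsets of one finite set, indexed by finitely many objects
  and fixed to be empty elsewhere; the last point counts when the type of objects is
  infinite.\<close>

lemma finite_simple_csubsets:
  assumes "is_cset C \<Omega>"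
  shows "finite (simple_csubsets C \<Omega>)"
proof (rule finite_subset)
  let ?F = "\<Union>a\<in>Obj C. Fib \<Omega> a"
  show "simple_csubsets C \<Omega> \<subseteq>
      {U. \<forall>a. (a \<in> Obj C \<longrightarrow> U a \<in> Pow ?F) \<and> (a \<notin> Obj C \<longrightarrow> U a = {})}"
    by (auto simp: simple_csubsets_def csubset_def)
  show "finite \<dots>"
    using finite_Obj is_cset_finite[OF assms] by (intro finite_set_of_finite_funs) auto
qed

text \<open>The images of one element under all arrows out of its object form a nonempty C-subset,
  so they exhaust a simple C-set; each fibre thus has at most as many elements as there are
  arrows.\<close>

lemma csize_simple_le:
  assumes simple: "simple_cset C \<Omega>"
  shows "csize C \<Omega> \<le> card (Obj C) * card (Arr C)"
proof -
  have \<Omega>: "is_cset C \<Omega>"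
    using simple by (rule simple_cset_is_cset)
  obtain a x where a: "a \<in> Obj C" and x: "x \<in> Fib \<Omega> a"
    using simple by (rule simple_cset_nonempty)
  \<comment> \<open>The C-subset generated by \<open>x\<close>: closed under the action by
    composition, and containing \<open>x\<close> by the identity arrow.\<close>
  define U where "U b = {Act \<Omega> f x |f. f \<in> Arr C \<and> Dom C f = a \<and> Cod C f = b}" for b
  have "csubset C U \<Omega>"
    unfolding csubset_def
  proof (intro conjI ballI allI impI)
    show "U b \<subseteq> Fib \<Omega> b" for b
      using is_cset_Act[OF \<Omega>] x by (auto simp: U_def)
    show "U b = {}" if "b \<notin> Obj C" for b
      using Cod_in that by (auto simp: U_def)
    show "Act \<Omega> g ` U (Dom C g) \<subseteq> U (Cod C g)" if g: "g \<in> Arr C" for g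
    proof
      fix y assume "y \<in> Act \<Omega> g ` U (Dom C g)"
      then obtain f where f: "f \<in> Arr C" "Dom C f = a" "Dom C g = Cod C f"
        and y: "y = Act \<Omega> g (Act \<Omega> f x)"
        by (auto simp: U_def)
      have "y = Act \<Omega> (Comp C g f) x"
        using is_cset_Comp[OF \<Omega>] f g x y by simp
      then show "y \<in> U (Cod C g)"
        using f g Comp_in Dom_Comp Cod_Comp unfolding U_def by blast
    qed
  qed
  moreover have "x \<in> U a"
    unfolding U_def using is_cset_Ident[OF \<Omega> a x] Ident_in[OF a] Dom_Ident[OF a] Cod_Ident[OF a]
    by force
  ultimately have "Fib \<Omega> b = U b" if "b \<in> Obj C" for b
    using csubset_simple_full[OF simple _ a _ that] by blast
  moreover have "card (U b) \<le> card (Arr C)" for b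
  proof -
    have "U b \<subseteq> (\<lambda>f. Act \<Omega> f x) ` Arr C"
      by (auto simp: U_def)
    then show ?thesis
      using finite_Arr by (rule surj_card_le[rotated])
  qed
  ultimately show ?thesis
    unfolding csize_def using sum_bounded_above[of "Obj C" "\<lambda>b. card (Fib \<Omega> b)" "card (Arr C)"]
    by simp
qed

end

section \<open>Simple subsets of a product\<close>

definition graph_csubset ::
    "('o, 'm) cat \<Rightarrow> ('o, 'm, 'x) cset \<Rightarrow> ('o \<Rightarrow> 'x \<Rightarrow> 'y) \<Rightarrow> 'o \<Rightarrow> ('x \<times> 'y) set" where
  "graph_csubset C S \<eta> a = (if a \<in> Obj C then (\<lambda>x. (x, \<eta> a x)) ` Fib S a else {})"

context finite_category
begin

text \<open>The map from \<open>x\<close> to \<open>(x, \<eta> a x)\<close> is an isomorphism of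
  \<open>S\<close> onto the graph, along which simplicity is transported.\<close>

lemma graph_csubset_simple:
  assumes S: "simple_cset C S" and T: "is_cset C T" and \<eta>: "\<eta> \<in> Hom C S T"
  shows "graph_csubset C S \<eta> \<in> simple_csubsets C (prod_cset S T)"
    and "cset_iso C S (restrict_cset (prod_cset S T) (graph_csubset C S \<eta>))"
proof -
  note S' = simple_cset_is_cset[OF S]
  have sub: "csubset C (graph_csubset C S \<eta>) (prod_cset S T)"
  proof (rule csubsetI)
    show "z \<in> Fib (prod_cset S T) a" if "a \<in> Obj C" "z \<in> graph_csubset C S \<eta> a" for a z
      using that Hom_Fib[OF \<eta>] by (auto simp: graph_csubset_def prod_cset_def)
    show "Act (prod_cset S T) f z \<in> graph_csubset C S \<eta> (Cod C f)"
      if f: "f \<in> Arr C" and z: "z \<in> graph_csubset C S \<eta> (Dom C f)" for f z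
    proof -
      obtain x where x: "x \<in> Fib S (Dom C f)" and z: "z = (x, \<eta> (Dom C f) x)"
        using z Dom_in[OF f] by (auto simp: graph_csubset_def)
      have "Act (prod_cset S T) f z = (Act S f x, \<eta> (Cod C f) (Act S f x))"
        using Hom_Act[OF \<eta> f x] by (simp add: prod_cset_def z)
      then show ?thesis
        using is_cset_Act[OF S' f x] Cod_in[OF f] by (simp add: graph_csubset_def)
    qed
  qed (simp add: graph_csubset_def)
  have "bij_betw (\<lambda>x. (x, \<eta> a x)) (Fib S a) (graph_csubset C S \<eta> a)" if "a \<in> Obj C" for a
    using that by (simp add: bij_betw_def graph_csubset_def inj_on_def)
  moreover have "(Act S f x, \<eta> (Cod C f) (Act S f x)) =
      Act (prod_cset S T) f (x, \<eta> (Dom C f) x)" if "f \<in> Arr C" "x \<in> Fib S (Dom C f)" for f x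
    using Hom_Act[OF \<eta> that] by (simp add: prod_cset_def)
  ultimately show iso: "cset_iso C S (restrict_cset (prod_cset S T) (graph_csubset C S \<eta>))"
    unfolding cset_iso_iff[OF S'] by (intro exI[where x = "\<lambda>a x. (x, \<eta> a x)"]) simp
  show "graph_csubset C S \<eta> \<in> simple_csubsets C (prod_cset S T)"
    unfolding simple_csubsets_def
    using sub simple_cset_iso[OF S is_cset_restrict[OF is_cset_prod[OF S' T] sub] iso] by simp
qed

text \<open>Members of \<open>Hom\<close> are extensional, so the values recorded in the graph
  determine them. Counting graphs therefore counts morphisms.\<close>

lemma inj_on_graph_csubset: "inj_on (graph_csubset C S) (Hom C S T)"
proof (rule inj_onI)
  fix \<eta> \<theta> assume \<eta>: "\<eta> \<in> Hom C S T" and \<theta>: "\<theta> \<in> Hom C S T"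
    and eq: "graph_csubset C S \<eta> = graph_csubset C S \<theta>"
  have "\<eta> a x = \<theta> a x" if "a \<in> Obj C" "x \<in> Fib S a" for a x
  proof -
    have "(x, \<eta> a x) \<in> graph_csubset C S \<theta> a"
      using that by (simp add: graph_csubset_def flip: eq)
    then show ?thesis
      using that(1) by (auto simp: graph_csubset_def)
  qed
  moreover have H: "\<eta> \<in> (\<Pi>\<^sub>E a\<in>Obj C. Fib S a \<rightarrow>\<^sub>E Fib T a)" "\<theta> \<in> (\<Pi>\<^sub>E a\<in>Obj C. Fib S a \<rightarrow>\<^sub>E Fib T a)"
    using \<eta> \<theta> by (simp_all add: Hom_def)
  ultimately have "\<eta> a = \<theta> a" if "a \<in> Obj C" for a
    using PiE_ext[OF PiE_mem[OF H(1) that] PiE_mem[OF H(2) that]] that by simp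
  with H show "\<eta> = \<theta>"
    by (rule PiE_ext)
qed

text \<open>The first projection of \<open>U\<close> is a nonempty C-subset of the simple C-set
  \<open>S\<close>.\<close>

lemma simple_csubset_prod_fst:
  assumes S: "simple_cset C S" and U: "U \<in> simple_csubsets C (prod_cset S T)" and b: "b \<in> Obj C"
  shows "fst ` U b = Fib S b"
proof -
  note sub = simple_csubsetD(1)[OF U]
  have "csubset C (\<lambda>a. fst ` U a) S"
  proof (rule csubsetI)
    show "x \<in> Fib S a" if "a \<in> Obj C" "x \<in> fst ` U a" for a x
      using csubset_Fib[OF sub that(1)] that(2) by (auto simp: prod_cset_def)
    show "Act S f x \<in> fst ` U (Cod C f)" if f: "f \<in> Arr C" and x: "x \<in> fst ` U (Dom C f)" for f x
    proof -
      obtain z where "z \<in> U (Dom C f)" and "x = fst z"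
        using x by blast
      moreover have "fst (Act (prod_cset S T) f z) = Act S f (fst z)"
        by (simp add: prod_cset_def)
      ultimately show ?thesis
        using csubset_Act[OF sub f] by (metis imageI)
    qed
  qed (simp add: csubset_off[OF sub])
  moreover obtain a z where a: "a \<in> Obj C" and "z \<in> U a"
    using simple_cset_nonempty[OF simple_csubsetD(2)[OF U]] by auto
  ultimately show ?thesis
    using csubset_simple_full[OF S _ a _ b] imageI by metis
qed

text \<open>Projection to \<open>S\<close> is onto in every fibre, so no fibre of \<open>U\<close>
  is smaller than that of \<open>S\<close>. If none is larger, the projection is bijective and the
  second coordinate is a function of the first.\<close>

lemma simple_csubset_prod_cases:
  assumes S: "simple_cset C S" and T: "is_cset C T"
    and U: "U \<in> simple_csubsets C (prod_cset S T)"
  shows "csize C S < csize C (restrict_cset (prod_cset S T) U) \<or> U \<in> graph_csubset C S ` Hom C S T"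
proof (rule disjCI)
  assume not_graph: "U \<notin> graph_csubset C S ` Hom C S T"
  note sub = simple_csubsetD(1)[OF U]
  note proj = simple_csubset_prod_fst[OF S U]
  have fin: "finite (U a)" if "a \<in> Obj C" for a
    using is_cset_finite[OF simple_cset_is_cset[OF simple_csubsetD(2)[OF U]] that] by simp
  have le: "card (Fib S a) \<le> card (U a)" if "a \<in> Obj C" for a
    using card_image_le[OF fin[OF that], of fst] proj[OF that] by simp
  have "\<exists>a\<in>Obj C. card (Fib S a) \<noteq> card (U a)"
  proof (rule ccontr)
    assume "\<not> ?thesis"
    then have inj: "inj_on fst (U a)" if "a \<in> Obj C" for a
      using that fin proj by (metis eq_card_imp_inj_on)
    \<comment> \<open>The second coordinate as a function of the first, unique by injectivity of
      \<open>fst\<close>; naturality will follow from closure of \<open>U\<close> under the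
      action.\<close>
    define \<eta> where "\<eta> = (\<lambda>a\<in>Obj C. \<lambda>x\<in>Fib S a. THE y. (x, y) \<in> U a)"
    have \<eta>_eq: "\<eta> a x = y" if "a \<in> Obj C" "(x, y) \<in> U a" for a x y
    proof -
      have "x \<in> Fib S a"
        using imageI[OF that(2), of fst] by (simp add: proj[OF that(1)])
      moreover have "(THE y. (x, y) \<in> U a) = y"
        using that(2) inj_onD[OF inj[OF that(1)]] by (intro the_equality) fastforce+
      ultimately show ?thesis
        using that by (simp add: \<eta>_def)
    qed
    have \<eta>_in: "(x, \<eta> a x) \<in> U a" if a: "a \<in> Obj C" "x \<in> Fib S a" for a x
    proof -
      obtain y where "(x, y) \<in> U a"
        using proj[OF a(1)] a(2) by force
      with \<eta>_eq[OF a(1)] show ?thesis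
        by simp
    qed
    have "U a = graph_csubset C S \<eta> a" for a
    proof (cases "a \<in> Obj C")
      case True
      have "U a = (\<lambda>x. (x, \<eta> a x)) ` fst ` U a"
        using \<eta>_eq[OF True] by (force simp: image_image)
      then show ?thesis
        using True by (simp add: graph_csubset_def proj)
    qed (simp add: graph_csubset_def csubset_off[OF sub])
    then have "U = graph_csubset C S \<eta>"
      by (rule ext)
    moreover have "\<eta> \<in> Hom C S T"
    proof -
      have "\<eta> a x \<in> Fib T a" if "a \<in> Obj C" "x \<in> Fib S a" for a x
        using csubset_Fib[OF sub that(1) \<eta>_in[OF that]] by (simp add: prod_cset_def)
      moreover have "\<eta> (Cod C f) (Act S f x) = Act T f (\<eta> (Dom C f) x)"
        if "f \<in> Arr C" "x \<in> Fib S (Dom C f)" for f x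
        using csubset_Act[OF sub that(1) \<eta>_in[OF Dom_in that(2)]] that Cod_in \<eta>_eq
        by (simp add: prod_cset_def)
      ultimately show ?thesis
        unfolding Hom_def by (simp add: PiE_iff \<eta>_def)
    qed
    ultimately show False
      using not_graph by blast
  qed
  then show "csize C S < csize C (restrict_cset (prod_cset S T) U)"
    unfolding csize_def using finite_Obj le
    by (intro sum_strict_mono_ex1) (auto simp: le_less)
qed

end

section \<open>Additive maps on the Burnside ring\<close>

lemma mark_eq_sum:
  assumes "finite A" and "Poly_Mapping.keys u \<subseteq> A"
  shows "mark C S u = (\<Sum>t\<in>A. Poly_Mapping.lookup u t * int (card (Hom C S (class_rep t))))"
  unfolding mark_def using assms by (intro sum.mono_neutral_left) (auto simp: in_keys_iff)

text \<open>Both marks are expanded over a common set of keys, where the extra coefficients vanish,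
  and subtracted term by term.\<close>

lemma mark_diff: "mark C S (u - v) = mark C S u - mark C S v"
proof -
  let ?A = "Poly_Mapping.keys u \<union> Poly_Mapping.keys v"
  have "Poly_Mapping.keys (u - v) \<subseteq> ?A"
    by (rule keys_diff)
  then show ?thesis
    by (simp add: mark_eq_sum[of ?A] lookup_minus left_diff_distrib sum_subtractf)
qed

lemma mark_frag_of: "mark C S (frag_of t) = int (card (Hom C S (class_rep t)))"
  by (simp add: mark_def)

text \<open>The additive inverses occurring in \<open>[n] \<cdot> \<one>\<close> are formed inside the carrier of the ring
  of integers, so its membership has to be checked.\<close>

lemma ring_of_integers_add_pow_one:
  fixes n :: int
  assumes "field K"
  shows "[n] \<cdot>\<^bsub>ring_of_integers K\<^esub> \<one>\<^bsub>ring_of_integers K\<^esub> = [n] \<cdot>\<^bsub>K\<^esub> \<one>\<^bsub>K\<^esub>"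
proof -
  interpret field K by fact
  let ?R = "ring_of_integers K"
  have mem: "[k] \<cdot>\<^bsub>K\<^esub> \<one>\<^bsub>K\<^esub> \<in> carrier ?R" for k :: int
  proof -
    have "algebraic_integer_in K ([k] \<cdot>\<^bsub>K\<^esub> \<one>\<^bsub>K\<^esub>)"
      unfolding algebraic_integer_in_def
      \<comment> \<open>The monic polynomial \<open>X - k\<close>; the list omits its leading
        coefficient.\<close>
      by (rule exI[where x = "[- k]"]) (simp add: add.int_pow_neg r_neg)
    then show ?thesis
      by (simp add: ring_of_integers_def)
  qed
  have nat: "[m] \<cdot>\<^bsub>?R\<^esub> x = [m] \<cdot>\<^bsub>K\<^esub> x" for m :: nat and x
    by (simp add: add_pow_def nat_pow_def ring_of_integers_def)
  show ?thesis
  proof (cases n)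
    case (nonneg m)
    then show ?thesis
      using nat[of m] by (simp add: add_pow_def int_pow_int ring_of_integers_def)
  next
    case (neg m)
    let ?x = "[Suc m] \<cdot>\<^bsub>K\<^esub> \<one>\<^bsub>K\<^esub>"
    have n: "[n] \<cdot>\<^bsub>K\<^esub> \<one>\<^bsub>K\<^esub> = \<ominus>\<^bsub>K\<^esub> ?x"
      unfolding neg by (simp add: add_pow_int_lt del: of_nat_Suc add.nat_pow_Suc)
    have "[n] \<cdot>\<^bsub>?R\<^esub> \<one>\<^bsub>?R\<^esub> = inv\<^bsub>add_monoid ?R\<^esub> ([Suc m] \<cdot>\<^bsub>?R\<^esub> \<one>\<^bsub>?R\<^esub>)"
      unfolding neg by (simp add: add_pow_def int_pow_def2 del: of_nat_Suc Group.nat_pow_Suc add.nat_pow_Suc)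
    also have "[Suc m] \<cdot>\<^bsub>?R\<^esub> \<one>\<^bsub>?R\<^esub> = ?x"
      unfolding nat by (simp add: ring_of_integers_def)
    also have "inv\<^bsub>add_monoid ?R\<^esub> ?x = \<ominus>\<^bsub>K\<^esub> ?x"
      unfolding m_inv_def
    proof (rule the_equality)
      have "?x \<in> carrier K"
        by simp
      then show "\<ominus>\<^bsub>K\<^esub> ?x \<in> carrier (add_monoid ?R) \<and>
          ?x \<otimes>\<^bsub>add_monoid ?R\<^esub> (\<ominus>\<^bsub>K\<^esub> ?x) = \<one>\<^bsub>add_monoid ?R\<^esub> \<and>
          (\<ominus>\<^bsub>K\<^esub> ?x) \<otimes>\<^bsub>add_monoid ?R\<^esub> ?x = \<one>\<^bsub>add_monoid ?R\<^esub>"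
        using mem[of n] by (simp add: n ring_of_integers_def r_neg l_neg)
      show "y = \<ominus>\<^bsub>K\<^esub> ?x" if "y \<in> carrier (add_monoid ?R) \<and>
          ?x \<otimes>\<^bsub>add_monoid ?R\<^esub> y = \<one>\<^bsub>add_monoid ?R\<^esub> \<and> y \<otimes>\<^bsub>add_monoid ?R\<^esub> ?x = \<one>\<^bsub>add_monoid ?R\<^esub>" for y
        using that by (intro minus_equality[symmetric]) (simp_all add: ring_of_integers_def)
    qed
    finally show ?thesis
      unfolding n .
  qed
qed

text \<open>The target is a domain so that \<open>\<phi>[S]\<close> can be cancelled; the theorem
  instantiates it with the number field itself.\<close>

locale burnside_hom = finite_category C + domain K
  for C :: "('o, 'm) cat" and K :: "('k, 'b) ring_scheme" +
  fixes \<phi> :: "(('o, 'm, nat) cset set \<Rightarrow>\<^sub>0 int) \<Rightarrow> 'k"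
  assumes hom: "\<phi> \<in> ring_hom (simple_burnside_ring C) K"
begin

abbreviation "carr \<equiv> {u :: ('o, 'm, nat) cset set \<Rightarrow>\<^sub>0 int. Poly_Mapping.keys u \<subseteq> simple_classes C}"

lemma hom_carrier: "u \<in> carr \<Longrightarrow> \<phi> u \<in> carrier K"
  using ring_hom_closed[OF hom] by (simp add: simple_burnside_ring_def carrier_free_Abelian_group_iff)

lemma hom_add: "u \<in> carr \<Longrightarrow> v \<in> carr \<Longrightarrow> \<phi> (u + v) = \<phi> u \<oplus>\<^bsub>K\<^esub> \<phi> v"
  using ring_hom_add[OF hom] by (simp add: simple_burnside_ring_def carrier_free_Abelian_group_iff)

lemma hom_mult: "u \<in> carr \<Longrightarrow> v \<in> carr \<Longrightarrow> \<phi> (burnside_mult C u v) = \<phi> u \<otimes>\<^bsub>K\<^esub> \<phi> v"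
  using ring_hom_mult[OF hom] by (simp add: simple_burnside_ring_def carrier_free_Abelian_group_iff)

lemma hom_one: "\<phi> (burnside_class C (one_cset :: ('o, 'm, unit) cset)) = \<one>\<^bsub>K\<^esub>"
  using ring_hom_one[OF hom] by (simp add: simple_burnside_ring_def burnside_class_soc)

lemma hom_zero: "\<phi> 0 = \<zero>\<^bsub>K\<^esub>"
  using hom_add[of 0 0] hom_carrier[of 0] by (simp add: add.l_cancel_one')

text \<open>\<open>ring_hom\<close> supplies sums only, whereas \<open>frag_induction\<close> builds
  elements by differences.\<close>

lemma hom_diff:
  assumes "u \<in> carr" and "v \<in> carr"
  shows "\<phi> (u - v) = \<phi> u \<ominus>\<^bsub>K\<^esub> \<phi> v"
proof -
  have mem: "u - v \<in> carr"
    using assms keys_diff[of u v] by auto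
  have "\<phi> u = \<phi> (u - v) \<oplus>\<^bsub>K\<^esub> \<phi> v"
    using hom_add[OF mem assms(2)] by simp
  then show ?thesis
    using hom_carrier[OF mem] hom_carrier[OF assms(2)]
    by (simp add: minus_eq a_assoc r_neg)
qed

text \<open>Used twice: with \<open>G\<close> the set of graphs to evaluate a product, and with
  \<open>G\<close> empty to evaluate the identity.\<close>

lemma hom_sum_frag_of:
  assumes "finite A" and "\<And>U. U \<in> A \<Longrightarrow> c U \<in> simple_classes C"
    and "\<And>U. U \<in> A \<Longrightarrow> \<phi> (frag_of (c U)) = (if U \<in> G then p else \<zero>\<^bsub>K\<^esub>)" and "p \<in> carrier K"
  shows "\<phi> (\<Sum>U\<in>A. frag_of (c U)) = [int (card (A \<inter> G))] \<cdot>\<^bsub>K\<^esub> p"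
  using assms(1-3)
proof (induction A rule: finite_induct)
  case empty
  then show ?case
    by (simp add: hom_zero add_pow_int_ge)
next
  case (insert U A)
  have "(\<Sum>U\<in>A. frag_of (c U)) \<in> carr"
    using keys_sum[of "\<lambda>U. frag_of (c U)" A] insert.prems(1) by auto
  then have "\<phi> (\<Sum>U\<in>insert U A. frag_of (c U)) = \<phi> (frag_of (c U)) \<oplus>\<^bsub>K\<^esub> \<phi> (\<Sum>U\<in>A. frag_of (c U))"
    using insert by (simp add: hom_add)
  also have "\<dots> = [int (card (insert U A \<inter> G))] \<cdot>\<^bsub>K\<^esub> p"
    using insert assms(4) by (simp add: add_pow_int_ge add.nat_pow_Suc a_comm)
  finally show ?case .
qed

text \<open>The identity is a sum of classes of simple C-sets; if all of these went to zero, so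
  would it, against \<open>hom_one\<close> in a domain.\<close>

lemma exists_hom_nonzero: "\<exists>s\<in>simple_classes C. \<phi> (frag_of s) \<noteq> \<zero>\<^bsub>K\<^esub>"
proof (rule ccontr)
  assume "\<not> ?thesis"
  moreover have one: "is_cset C (one_cset :: ('o, 'm, unit) cset)"
    by (simp add: is_cset_def one_cset_def)
  ultimately have "\<phi> (burnside_class C (one_cset :: ('o, 'm, unit) cset)) =
      [int (card (simple_csubsets C (one_cset :: ('o, 'm, unit) cset) \<inter> {}))] \<cdot>\<^bsub>K\<^esub> \<zero>\<^bsub>K\<^esub>"
    unfolding burnside_class_def
    by (intro hom_sum_frag_of finite_simple_csubsets) (auto simp: simple_csubsetD class_rep_simple(4))
  then show False
    using hom_one by simp
qed

lemma hom_eq_mark_frag_of: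
  assumes s: "s \<in> simple_classes C" and nz: "\<phi> (frag_of s) \<noteq> \<zero>\<^bsub>K\<^esub>"
    and max: "\<And>t. t \<in> simple_classes C \<Longrightarrow> \<phi> (frag_of t) \<noteq> \<zero>\<^bsub>K\<^esub> \<Longrightarrow>
      csize C (class_rep t) \<le> csize C (class_rep s)"
    and t: "t \<in> simple_classes C"
  shows "\<phi> (frag_of t) = [mark C (class_rep s) (frag_of t)] \<cdot>\<^bsub>K\<^esub> \<one>\<^bsub>K\<^esub>"
proof -
  let ?S = "class_rep s" and ?T = "class_rep t"
  let ?P = "prod_cset ?S ?T" and ?G = "graph_csubset C ?S ` Hom C ?S ?T"
  have S: "simple_cset C ?S" and T: "is_cset C ?T"
    using simple_classes_rep s t simple_cset_is_cset by blast+
  have P: "is_cset C ?P"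
    using is_cset_prod simple_cset_is_cset[OF S] T by blast
  have p: "\<phi> (frag_of s) \<in> carrier K" and q: "\<phi> (frag_of t) \<in> carrier K"
    using s t hom_carrier by simp_all
  have GP: "simple_csubsets C ?P \<inter> ?G = ?G"
    using graph_csubset_simple(1)[OF S T] by blast
  \<comment> \<open>Graphs are copies of \<open>S\<close> and contribute \<open>\<phi>[S]\<close>;
    all other simple subsets are too large to survive.\<close>
  have val: "\<phi> (frag_of (cset_class C (restrict_cset ?P U))) =
      (if U \<in> ?G then \<phi> (frag_of s) else \<zero>\<^bsub>K\<^esub>)" if U: "U \<in> simple_csubsets C ?P" for U
  proof (cases "U \<in> ?G")
    case True
    then obtain \<eta> where "\<eta> \<in> Hom C ?S ?T" "U = graph_csubset C ?S \<eta>"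
      by blast
    then have "cset_class C ?S = cset_class C (restrict_cset ?P U)"
      using graph_csubset_simple(2)[OF S T] simple_cset_is_cset[OF S]
        simple_cset_is_cset[OF simple_csubsetD(2)[OF U]] cset_class_eq by blast
    then show ?thesis
      using True simple_classes_rep(2)[OF s] by simp
  next
    case False
    note simple = simple_csubsetD(2)[OF U]
    \<comment> \<open>Maximality concerns chosen representatives, so the strict inequality is
      carried over from \<open>U\<close> by isomorphism invariance.\<close>
    have "csize C ?S < csize C (class_rep (cset_class C (restrict_cset ?P U)))"
      using simple_csubset_prod_cases[OF S T U] False
        csize_iso[OF simple_cset_is_cset[OF simple] class_rep_simple(2)[OF simple]] by simp
    then show ?thesis
      using max[OF class_rep_simple(4)[OF simple]] False by (auto simp: not_le)
  qed
  have "\<phi> (frag_of s) \<otimes>\<^bsub>K\<^esub> \<phi> (frag_of t) = \<phi> (burnside_class C ?P)"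
    using hom_mult[of "frag_of s" "frag_of t"] s t
    by (simp add: burnside_mult_def burnside_class_soc)
  also have "\<dots> = [int (card ?G)] \<cdot>\<^bsub>K\<^esub> \<phi> (frag_of s)"
    unfolding burnside_class_def
    using hom_sum_frag_of[OF finite_simple_csubsets[OF P] class_rep_simple(4)[OF simple_csubsetD(2)]
      val p] unfolding GP by simp
  also have "card ?G = card (Hom C ?S ?T)"
    by (rule card_image[OF inj_on_graph_csubset])
  \<comment> \<open>The multiple of \<open>\<phi>[S]\<close> becomes a product with factor
    \<open>\<phi>[S]\<close>, ready for cancellation.\<close>
  also have "[int (card (Hom C ?S ?T))] \<cdot>\<^bsub>K\<^esub> \<phi> (frag_of s) =
      \<phi> (frag_of s) \<otimes>\<^bsub>K\<^esub> ([mark C ?S (frag_of t)] \<cdot>\<^bsub>K\<^esub> \<one>\<^bsub>K\<^esub>)"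
    using p by (simp add: mark_frag_of add_pow_rdistr_int)
  finally show ?thesis
    using m_lcancel[OF nz p q] by simp
qed

text \<open>The size bound yields a generator of maximal size outside the kernel; both sides respect
  differences, so agreement on generators spreads to the whole ring.\<close>

lemma hom_eq_mark:
  obtains S :: "('o, 'm, nat) cset" where "simple_cset C S"
    and "\<And>u. u \<in> carr \<Longrightarrow> \<phi> u = [mark C S u] \<cdot>\<^bsub>K\<^esub> \<one>\<^bsub>K\<^esub>"
proof -
  let ?P = "\<lambda>s. s \<in> simple_classes C \<and> \<phi> (frag_of s) \<noteq> \<zero>\<^bsub>K\<^esub>"
  obtain k where "?P k"
    using exists_hom_nonzero by blast
  moreover have "\<forall>t. ?P t \<longrightarrow> csize C (class_rep t) < Suc (card (Obj C) * card (Arr C))"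
    by (auto simp only: less_Suc_eq_le intro: csize_simple_le simple_classes_rep(1))
  ultimately have "\<exists>s. ?P s \<and> (\<forall>t. ?P t \<longrightarrow> csize C (class_rep t) \<le> csize C (class_rep s))"
    by (rule ex_has_greatest_nat)
  then obtain s where s: "?P s"
    and max: "\<And>t. ?P t \<Longrightarrow> csize C (class_rep t) \<le> csize C (class_rep s)"
    by blast
  \<comment> \<open>Membership is carried through the induction because \<open>hom_diff\<close>
    requires it of both terms.\<close>
  have "u \<in> carr \<and> \<phi> u = [mark C (class_rep s) u] \<cdot>\<^bsub>K\<^esub> \<one>\<^bsub>K\<^esub>" if "u \<in> carr" for u
    using that[THEN CollectD]
  proof (induction u rule: frag_induction)
    case zero
    show ?case
      by (simp add: hom_zero mark_def add_pow_int_ge)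
  next
    case (one t)
    have "\<phi> (frag_of t) = [mark C (class_rep s) (frag_of t)] \<cdot>\<^bsub>K\<^esub> \<one>\<^bsub>K\<^esub>"
      by (rule hom_eq_mark_frag_of) (use s max one in blast)+
    with one show ?case
      by simp
  next
    case (diff u v)
    then have "\<phi> (u - v) = [mark C (class_rep s) u] \<cdot>\<^bsub>K\<^esub> \<one>\<^bsub>K\<^esub> \<ominus>\<^bsub>K\<^esub> [mark C (class_rep s) v] \<cdot>\<^bsub>K\<^esub> \<one>\<^bsub>K\<^esub>"
      using hom_diff by metis
    also have "\<dots> = [mark C (class_rep s) (u - v)] \<cdot>\<^bsub>K\<^esub> \<one>\<^bsub>K\<^esub>"
      unfolding mark_diff minus_eq by (rule add.int_pow_diff[symmetric]) simp
    finally show ?case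
      using diff keys_diff[of u v] by blast
  qed
  moreover have "simple_cset C (class_rep s)"
    using simple_classes_rep(1) s by blast
  ultimately show ?thesis
    using that by simp
qed

end

section \<open>Passage between the ring of integers and its number field\<close>

theorem theorem4p3:
  fixes C :: "('o, 'm) cat"
    and K :: "('k, 'b) ring_scheme"
    and \<phi> :: "(('o, 'm, nat) cset set \<Rightarrow>\<^sub>0 int) \<Rightarrow> 'k"
  defines "B \<equiv> simple_burnside_ring C"
    and "R \<equiv> ring_of_integers K"
  assumes "finite_connected_category C"
    and "number_field K"
    and "\<phi> \<in> ring_hom B R"
  shows "\<exists>S :: ('o, 'm, nat) cset. simple_cset C S \<and>
           (\<forall>u\<in>carrier B. \<phi> u = [mark C S u] \<cdot>\<^bsub>R\<^esub> \<one>\<^bsub>R\<^esub>)"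
proof -
  interpret finite_connected_category C by fact
  have K: "field K"
    using assms(4) by (simp add: number_field_def)
  then interpret field K .
  \<comment> \<open>\<open>R\<close> differs from \<open>K\<close> only in its smaller carrier, so
    \<open>\<phi>\<close> is also a homomorphism into the field.\<close>
  have "\<phi> \<in> ring_hom (simple_burnside_ring C) K"
    using assms(5) unfolding ring_hom_def B_def R_def ring_of_integers_def by auto
  then interpret burnside_hom C K \<phi>
    by unfold_locales
  obtain S :: "('o, 'm, nat) cset" where "simple_cset C S"
    and "\<And>u. u \<in> carr \<Longrightarrow> \<phi> u = [mark C S u] \<cdot>\<^bsub>K\<^esub> \<one>\<^bsub>K\<^esub>"
    using hom_eq_mark by blast
  then show ?thesis
    unfolding B_def R_def ring_of_integers_add_pow_one[OF K]
    by (auto simp: simple_burnside_ring_def carrier_free_Abelian_group_iff)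
qed

end
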